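(* Let $w\in S_n$, and fix any term order on monomials in $x_1,\ldots,x_n$ satisfying $x_1<x_2<\cdots<x_n$. Then $$\mathbf{x}^{\overline{\mathrm{rajcode}}(w)}=\min\left\{\mathbf{x}^{\overline{\mathrm{wt}}(C,M(C))}\ \middle|\ C\text{ is a heavy climbing chain of }w\right\}.$$ Equivalently, $$\mathbf{x}^{\mathrm{rajcode}(w)}=\max\left\{\mathbf{x}^{\mathrm{wt}(C,M(C))}\ \middle|\ C\text{ is a heavy climbing chain of }w\right\}.$$ Here min and max are taken with respect to the term order.
   Context: Conventions. Permutations are in one-line notation; $t_{ij}$ is the transposition of $i,j$, and $wt_{ij}$ is $w$ with the values in positions $i$ and $j$ exchanged. $w_0\in S_n$ is the longest permutation, $w_0(k)=n+1-k$. The Bruhat order is the transitive closure of $w\le wt_{ij}$ for $i<j$ with $w(i)<w(j)$; $\lessdot$ denotes its cover relation. $\mathbf{x}^v=\prod_k x_k^{v_k}$, $|v|=\sum_k v_k$, and $[n]=\{1,\ldots,n\}$. Climbing chains. A climbing chain of $w\in S_n$ is a sequence $C=(C_1,\ldots,C_m)$ of pairs (links) $C_p=(i_p,j_p)$ with $i_p<j_p$, $i_1\le\cdots\le i_m$, $wt_{i_1j_1}\cdots t_{i_mj_m}=w_0$, and $wt_{i_1j_1}\cdots t_{i_{p-1}j_{p-1}}\lessdot wt_{i_1j_1}\cdots t_{i_pj_p}$ for each $p\in[m]$. (The only climbing chain of $w_0$ is empty. The links of a chain are distinct, so $C$ is also regarded as a set.) The set of minimal markings is $M(C)=\{C_p\mid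 i_{p-1}<i_p,\text{ or } i_{p-1}=i_p\text{ and }j_{p-1}<j_p\}$ with $i_0=0$. For $M(C)\subseteq U\subseteq C$, the dual weight $\overline{\mathrm{wt}}(C,U)\in\mathbb{Z}^n$ has $k$th entry the number of links of the form $(k,\star)$ in $U$, and the weight has $\mathrm{wt}(C,U)_k=n-k-\overline{\mathrm{wt}}(C,U)_k$. Codes. $\overline{\mathrm{rajcode}}(w)_i$ is the maximal number $r$ of positions in a sequence $i=\alpha_1<\cdots<\alpha_r\le n$ with $w(\alpha_1)<\cdots<w(\alpha_r)$, minus one. $\mathrm{rajcode}(w)_k=n-k-\overline{\mathrm{rajcode}}(w)_k$, and $\overline{\mathrm{raj}}(w)=|\overline{\mathrm{rajcode}}(w)|$. A climbing chain $C$ of $w$ is heavy if $\#M(C)=\overline{\mathrm{raj}}(w)$. *)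

theory Defs
  imports "HOL-Combinatorics.Permutations" "HOL-Library.Poly_Mapping"
begin

text \<open>
  An element of the symmetric group \<open>S_n\<close> is a function \<open>w :: nat \<Rightarrow> nat\<close> with
  \<open>w permutes {1..n}\<close>. Vectors indexed by \<open>[n]\<close> are functions on \<open>nat\<close> of which only the
  values on \<open>{1..n}\<close> matter.
\<close>

definition longest_perm :: "nat \<Rightarrow> nat \<Rightarrow> nat" where
  "longest_perm n = (\<lambda>k. if k \<in> {1..n} then n + 1 - k else k)"

definition bruhat_le :: "nat \<Rightarrow> ((nat \<Rightarrow> nat) \<times> (nat \<Rightarrow> nat)) set" where
  "bruhat_le n =
     {(w, w \<circ> transpose i j) | w i j.
        w permutes {1..n} \<and> i \<in> {1..n} \<and> j \<in> {1..n} \<and> i < j \<and> w i < w j}\<^sup>*"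

definition bruhat_cover :: "nat \<Rightarrow> (nat \<Rightarrow> nat) \<Rightarrow> (nat \<Rightarrow> nat) \<Rightarrow> bool" where
  "bruhat_cover n u v \<longleftrightarrow>
     (u, v) \<in> bruhat_le n \<and> u \<noteq> v \<and>
     (\<forall>z. (u, z) \<in> bruhat_le n \<and> (z, v) \<in> bruhat_le n \<longrightarrow> z = u \<or> z = v)"


definition apply_links :: "(nat \<Rightarrow> nat) \<Rightarrow> (nat \<times> nat) list \<Rightarrow> (nat \<Rightarrow> nat)" where
  "apply_links w C = foldl (\<lambda>v (i, j). v \<circ> transpose i j) w C"

definition climbing_chain :: "nat \<Rightarrow> (nat \<Rightarrow> nat) \<Rightarrow> (nat \<times> nat) list \<Rightarrow> bool" where
  "climbing_chain n w C \<longleftrightarrow>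
     (\<forall>(i, j) \<in> set C. i \<in> {1..n} \<and> j \<in> {1..n} \<and> i < j) \<and>
     sorted (map fst C) \<and>
     apply_links w C = longest_perm n \<and>
     (\<forall>p < length C. bruhat_cover n (apply_links w (take p C)) (apply_links w (take (Suc p) C)))"

text \<open>List positions are counted from 0, so \<open>p = 0\<close> is the first link, for which the
  preceding first index is 0 by convention.\<close>

definition min_markings :: "(nat \<times> nat) list \<Rightarrow> (nat \<times> nat) set" where
  "min_markings C =
     {C ! p | p. p < length C \<and>
        ((if p = 0 then 0 else fst (C ! (p - 1))) < fst (C ! p) \<or>
         (p > 0 \<and> fst (C ! (p - 1)) = fst (C ! p) \<and> snd (C ! (p - 1)) < snd (C ! p)))}"

text \<open>The dual weight of \<open>(C, U)\<close> depends on the set \<open>U\<close> of marked links only.\<close>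

definition dual_weight :: "(nat \<times> nat) set \<Rightarrow> nat \<Rightarrow> int" where
  "dual_weight U k = int (card {l \<in> U. fst l = k})"

definition weight :: "nat \<Rightarrow> (nat \<times> nat) set \<Rightarrow> nat \<Rightarrow> int" where
  "weight n U k = int n - int k - dual_weight U k"


definition dual_rajcode :: "nat \<Rightarrow> (nat \<Rightarrow> nat) \<Rightarrow> nat \<Rightarrow> int" where
  "dual_rajcode n w i =
     int (Max {length \<alpha> | \<alpha>.
       \<alpha> \<noteq> [] \<and> hd \<alpha> = i \<and> set \<alpha> \<subseteq> {1..n} \<and>
       sorted_wrt (<) \<alpha> \<and> sorted_wrt (<) (map w \<alpha>)}) - 1"

definition rajcode :: "nat \<Rightarrow> (nat \<Rightarrow> nat) \<Rightarrow> nat \<Rightarrow> int" where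
  "rajcode n w k = int n - int k - dual_rajcode n w k"

definition dual_raj :: "nat \<Rightarrow> (nat \<Rightarrow> nat) \<Rightarrow> int" where
  "dual_raj n w = (\<Sum>k\<in>{1..n}. dual_rajcode n w k)"

definition heavy_climbing_chain :: "nat \<Rightarrow> (nat \<Rightarrow> nat) \<Rightarrow> (nat \<times> nat) list \<Rightarrow> bool" where
  "heavy_climbing_chain n w C \<longleftrightarrow>
     climbing_chain n w C \<and> int (card (min_markings C)) = dual_raj n w"


text \<open>
  A monomial in \<open>x_1, \<dots>, x_n\<close> is represented by its exponent vector, a finitely supported
  map; multiplication of monomials is addition of exponent vectors, and the monomial 1 is the
  zero map.
\<close>

type_synonym monomial = "nat \<Rightarrow>\<^sub>0 nat"

definition monomials :: "nat \<Rightarrow> monomial set" where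
  "monomials n = {m. Poly_Mapping.keys m \<subseteq> {1..n}}"

abbreviation var :: "nat \<Rightarrow> monomial" where
  "var k \<equiv> Poly_Mapping.single k 1"

text \<open>The monomial \<open>x^v\<close>, for \<open>v\<close> with nonnegative entries on \<open>[n]\<close>; the lemmas at the end
  show that \<open>nat\<close> never truncates the weights and codes above.\<close>

definition xpow :: "nat \<Rightarrow> (nat \<Rightarrow> int) \<Rightarrow> monomial" where
  "xpow n v = (\<Sum>k\<in>{1..n}. Poly_Mapping.single k (nat (v k)))"

text \<open>A term order is a multiplicative total order with least element 1 (by Dickson's lemma it
  is then a well-order). It is given as the reflexive relation: \<open>(a, b) \<in> r\<close> means \<open>a \<le> b\<close>.\<close>

definition term_order :: "nat \<Rightarrow> monomial rel \<Rightarrow> bool" where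
  "term_order n r \<longleftrightarrow>
     linear_order_on (monomials n) r \<and>
     (\<forall>m \<in> monomials n. (0, m) \<in> r) \<and>
     (\<forall>a \<in> monomials n. \<forall>b \<in> monomials n. \<forall>c \<in> monomials n.
        (a, b) \<in> r \<longrightarrow> (a + c, b + c) \<in> r)"

definition is_min :: "'a rel \<Rightarrow> 'a set \<Rightarrow> 'a \<Rightarrow> bool" where
  "is_min r S m \<longleftrightarrow> m \<in> S \<and> (\<forall>y \<in> S. (m, y) \<in> r)"

definition is_max :: "'a rel \<Rightarrow> 'a set \<Rightarrow> 'a \<Rightarrow> bool" where
  "is_max r S m \<longleftrightarrow> m \<in> S \<and> (\<forall>y \<in> S. (y, m) \<in> r)"


lemma lookup_xpow:
  assumes "k \<in> {1..n}" and "0 \<le> v k"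
  shows "int (Poly_Mapping.lookup (xpow n v) k) = v k"
proof -
  have "Poly_Mapping.lookup (xpow n v) k = (\<Sum>l\<in>{1..n}. if l = k then nat (v l) else 0)"
    unfolding xpow_def lookup_sum by (intro sum.cong) (auto simp: lookup_single when_def)
  also have "\<dots> = nat (v k)"
    using assms(1) by simp
  finally show ?thesis using assms(2) by simp
qed

lemma dual_weight_nonneg: "0 \<le> dual_weight U k"
  by (simp add: dual_weight_def)

lemma weight_nonneg:
  assumes "climbing_chain n w C" and "U \<subseteq> set C" and "k \<in> {1..n}"
  shows "0 \<le> weight n U k"
proof -
  have "{l \<in> U. fst l = k} \<subseteq> {k} \<times> {k+1..n}"
    using assms(1,2) unfolding climbing_chain_def by fastforce
  then have "card {l \<in> U. fst l = k} \<le> card ({k} \<times> {k+1..n})"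
    by (intro card_mono) auto
  then show ?thesis
    using assms(3) by (auto simp: weight_def dual_weight_def card_cartesian_product)
qed

lemma min_markings_subset: "min_markings C \<subseteq> set C"
  by (auto simp: min_markings_def)

lemma dual_rajcode_bounds:
  assumes "i \<in> {1..n}"
  shows "0 \<le> dual_rajcode n w i" and "0 \<le> rajcode n w i"
proof -
  let ?L = "{length \<alpha> | \<alpha>. \<alpha> \<noteq> [] \<and> hd \<alpha> = i \<and> set \<alpha> \<subseteq> {1..n} \<and>
       sorted_wrt (<) \<alpha> \<and> sorted_wrt (<) (map w \<alpha>)}"
  have bound: "r \<le> n + 1 - i" if "r \<in> ?L" for r
  proof -
    from that obtain \<alpha> where a: "r = length \<alpha>" "\<alpha> \<noteq> []" "hd \<alpha> = i" "set \<alpha> \<subseteq> {1..n}"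
      "sorted_wrt (<) \<alpha>" by auto
    have "distinct \<alpha>" using a(5) by (simp add: strict_sorted_iff)
    have "set \<alpha> \<subseteq> {i..n}"
      using a(2-5) by (cases \<alpha>) (auto simp: subset_iff less_imp_le)
    then have "card (set \<alpha>) \<le> card {i..n}" by (intro card_mono) auto
    with \<open>distinct \<alpha>\<close> a(1) show ?thesis by (simp add: distinct_card)
  qed
  have "finite ?L"
    by (rule finite_subset[of _ "{..n + 1 - i}"]) (use bound in auto)
  moreover have "length [i] \<in> ?L"
    using assms by (intro CollectI exI[of _ "[i]"]) auto
  ultimately have "1 \<le> Max ?L" and "Max ?L \<le> n + 1 - i"
    using Max_ge[of ?L "length [i]"] Max_in[of ?L] bound by auto
  then show "0 \<le> dual_rajcode n w i" and "0 \<le> rajcode n w i"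
    using assms by (auto simp: rajcode_def dual_rajcode_def)
qed

end

theory Submission
  imports Defs
begin

text \<open>
  Swapping the values at \<open>i < j\<close> along a Bruhat cover cannot lower the dual rajcode at any position
  right of \<open>i\<close>, and a run of swaps with fixed \<open>i\<close> and decreasing \<open>j\<close> lowers the sum of the codes
  from \<open>i\<close> on by at most one. As the minimal markings are the starts of these runs, every climbing
  chain has at least \<open>\<Sum>k\<ge>b. dual_rajcode n w k\<close> minimal markings in rows \<open>\<ge> b\<close>, for each \<open>b\<close>. For a
  heavy chain equality holds at \<open>b = 1\<close>, and dominance of tail sums at equal degree implies
  comparability in every term order with \<open>x_1 < \<dots> < x_n\<close>. A greedy chain attains the bound in
  each row.
\<close>

declare o_apply [simp del] \<comment> \<open>keeps \<open>u \<circ> transpose i j\<close> folded\<close>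

section \<open>Recursion for the dual rajcode\<close>

definition increasing_lengths :: "nat \<Rightarrow> (nat \<Rightarrow> nat) \<Rightarrow> nat \<Rightarrow> nat set" where
  "increasing_lengths n u k = {length \<alpha> | \<alpha>. \<alpha> \<noteq> [] \<and> hd \<alpha> = k \<and> set \<alpha> \<subseteq> {1..n} \<and>
     sorted_wrt (<) \<alpha> \<and> sorted_wrt (<) (map u \<alpha>)}"

lemma dual_rajcode_alt: "dual_rajcode n u k = int (Max (increasing_lengths n u k)) - 1"
  by (simp add: dual_rajcode_def increasing_lengths_def)

lemma finite_increasing_lengths: "finite (increasing_lengths n u k)"
proof (rule finite_subset)
  show "increasing_lengths n u k \<subseteq> {..n}"
  proof
    fix r assume "r \<in> increasing_lengths n u k"
    then obtain \<alpha> where a: "r = length \<alpha>" "set \<alpha> \<subseteq> {1..n}" "sorted_wrt (<) \<alpha>"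
      by (auto simp: increasing_lengths_def)
    have "length \<alpha> = card (set \<alpha>)"
      using a(3) by (simp add: strict_sorted_iff distinct_card)
    also have "\<dots> \<le> card {1..n}"
      using a(2) by (intro card_mono) auto
    finally show "r \<in> {..n}" using a(1) by simp
  qed
qed simp

lemma dual_rajcode_ge_length:
  "r \<in> increasing_lengths n u k \<Longrightarrow> int r \<le> dual_rajcode n u k + 1"
  by (simp add: dual_rajcode_alt finite_increasing_lengths)

lemma dual_rajcode_attained:
  assumes "k \<in> {1..n}"
  obtains \<alpha> where "int (length (k # \<alpha>)) = dual_rajcode n u k + 1" "set \<alpha> \<subseteq> {1..n}"
    "sorted_wrt (<) (k # \<alpha>)" "sorted_wrt (<) (map u (k # \<alpha>))"
proof -
  have "length [k] \<in> increasing_lengths n u k"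
    unfolding increasing_lengths_def using assms by (intro CollectI exI[of _ "[k]"]) auto
  then have "Max (increasing_lengths n u k) \<in> increasing_lengths n u k"
    by (intro Max_in finite_increasing_lengths) auto
  then obtain \<beta> where b: "Max (increasing_lengths n u k) = length \<beta>" "\<beta> \<noteq> []" "hd \<beta> = k"
    "set \<beta> \<subseteq> {1..n}" "sorted_wrt (<) \<beta>" "sorted_wrt (<) (map u \<beta>)"
    by (auto simp: increasing_lengths_def)
  then obtain \<alpha> where "\<beta> = k # \<alpha>" by (cases \<beta>) auto
  with b that[of \<alpha>] show thesis by (auto simp: dual_rajcode_alt)
qed

lemma dual_rajcode_less:
  assumes "k \<in> {1..n}" "x \<in> {k<..n}" "u k < u x"
  shows "dual_rajcode n u x + 1 \<le> dual_rajcode n u k"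
proof -
  have "x \<in> {1..n}" using assms by auto
  then obtain \<alpha> where a: "int (length (x # \<alpha>)) = dual_rajcode n u x + 1" "set \<alpha> \<subseteq> {1..n}"
    "sorted_wrt (<) (x # \<alpha>)" "sorted_wrt (<) (map u (x # \<alpha>))"
    by (rule dual_rajcode_attained)
  have "length (k # x # \<alpha>) \<in> increasing_lengths n u k"
    unfolding increasing_lengths_def using assms a(2-4)
    by (intro CollectI exI[of _ "k # x # \<alpha>"]) auto
  from dual_rajcode_ge_length[OF this] a(1) show ?thesis by simp
qed

text \<open>Dropping the first position of a longest sequence from \<open>k\<close> leaves a longest
  one from the second position. With \<open>dual_rajcode_less\<close> this gives a right-to-left
  recursion for the code, so that no later argument handles sequences themselves.\<close>

lemma dual_rajcode_cases:
  assumes "k \<in> {1..n}"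
  obtains (zero) "dual_rajcode n u k = 0"
  | (next_pos) x where "x \<in> {k<..n}" "u k < u x" "dual_rajcode n u k = dual_rajcode n u x + 1"
proof -
  obtain \<alpha> where a: "int (length (k # \<alpha>)) = dual_rajcode n u k + 1" "set \<alpha> \<subseteq> {1..n}"
    "sorted_wrt (<) (k # \<alpha>)" "sorted_wrt (<) (map u (k # \<alpha>))"
    using assms by (rule dual_rajcode_attained)
  show thesis
  proof (cases \<alpha>)
    case Nil
    with a(1) zero show thesis by simp
  next
    case (Cons x \<beta>)
    have x: "x \<in> {k<..n}" "u k < u x" using a Cons by auto
    have "length \<alpha> \<in> increasing_lengths n u x"
      unfolding increasing_lengths_def using a Cons by (intro CollectI exI[of _ \<alpha>]) auto
    from dual_rajcode_ge_length[OF this] a(1) have "dual_rajcode n u k \<le> dual_rajcode n u x + 1"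
      by simp
    with dual_rajcode_less[of k n x u] assms x next_pos[of x] show thesis by force
  qed
qed

section \<open>Effect of a covering swap on the codes to its right\<close>

locale transposition_cover =
  fixes n :: nat and u :: "nat \<Rightarrow> nat" and i j :: nat
  assumes perm: "u permutes {1..n}"
    and bounds: "1 \<le> i" "i < j" "j \<le> n"
    and ascent: "u i < u j"
    and gap: "\<And>k. i < k \<Longrightarrow> k < j \<Longrightarrow> \<not> (u i < u k \<and> u k < u j)"
begin

abbreviation "v \<equiv> u \<circ> transpose i j"

lemma v_simps [simp]: "v i = u j" "v j = u i" "k \<noteq> i \<Longrightarrow> k \<noteq> j \<Longrightarrow> v k = u k"
  by (auto simp: o_apply transpose_def)

lemma u_eq_iff: "u x = u y \<longleftrightarrow> x = y"
  using perm by (metis permutes_inj injD)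

lemma gap_cases:
  assumes "i < k" "k < j"
  shows "u k < u i \<or> u j < u k"
  using gap[OF assms] u_eq_iff[of k i] u_eq_iff[of k j] assms by auto

text \<open>Ascents of \<open>u\<close> between positions right of \<open>i\<close> survive in
  \<open>v\<close>: only the value at \<open>j\<close> changes there, it falls to
  \<open>u i\<close>, and by \<open>gap\<close> it passes no value at a position between
  \<open>i\<close> and \<open>j\<close>.\<close>

lemma dual_rajcode_mono:
  assumes "i < k" "k \<le> n"
  shows "dual_rajcode n u k \<le> dual_rajcode n v k"
  using assms
proof (induction "n - k" arbitrary: k rule: less_induct)
  case less
  have k: "k \<in> {1..n}" using less.prems by auto
  from k show ?case
  proof (cases rule: dual_rajcode_cases[where u = u])
    case zero
    then show ?thesis using dual_rajcode_bounds(1)[OF k] by simp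
  next
    case (next_pos x)
    have "v k < v x"
    proof (cases "k = j")
      case True
      then show ?thesis using next_pos less.prems bounds ascent by auto
    next
      case False
      then show ?thesis using next_pos less.prems gap_cases[of k] ascent
        by (cases "x = j") auto
    qed
    then have "dual_rajcode n v x + 1 \<le> dual_rajcode n v k"
      using k next_pos by (intro dual_rajcode_less) auto
    moreover have "dual_rajcode n u x \<le> dual_rajcode n v x"
      using next_pos less.prems by (intro less.hyps) auto
    ultimately show ?thesis using next_pos by simp
  qed
qed

text \<open>Right of \<open>i\<close>, the ascents that \<open>v\<close> has and \<open>u\<close>
  lacks all start at \<open>j\<close>. By the first hypothesis the codes reached along them are too
  small to raise the code at \<open>j\<close>.\<close>

lemma dual_rajcode_stable:
  assumes "\<And>x. j < x \<Longrightarrow> x \<le> n \<Longrightarrow> u i < u x \<Longrightarrow> dual_rajcode n u x + 1 \<le> dual_rajcode n u j"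
    and "i < k" "k \<le> n"
  shows "dual_rajcode n v k = dual_rajcode n u k"
proof -
  have "dual_rajcode n v k \<le> dual_rajcode n u k"
    using assms(2,3)
  proof (induction "n - k" arbitrary: k rule: less_induct)
    case less
    have k: "k \<in> {1..n}" using less.prems by auto
    from k show ?case
    proof (cases rule: dual_rajcode_cases[where u = v])
      case zero
      then show ?thesis using dual_rajcode_bounds(1)[OF k] by simp
    next
      case (next_pos x)
      have le: "dual_rajcode n v x \<le> dual_rajcode n u x"
        using next_pos less.prems by (intro less.hyps) auto
      have "dual_rajcode n u x + 1 \<le> dual_rajcode n u k"
      proof (cases "k = j")
        case True
        then show ?thesis using next_pos bounds assms(1)[of x] by auto
      next
        case False
        then have "u k < u x"
          using next_pos less.prems ascent by (cases "x = j") auto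
        then show ?thesis using k next_pos by (intro dual_rajcode_less) auto
      qed
      then show ?thesis using le next_pos by simp
    qed
  qed
  then show ?thesis using dual_rajcode_mono[OF assms(2,3)] by simp
qed

lemma i_in: "i \<in> {1..n}" and j_in: "j \<in> {1..n}"
  using bounds by auto

end

section \<open>Loss of code along a descending run\<close>

text \<open>\<open>attained_beyond n u i J\<close>: some longest increasing subsequence starting at position \<open>i\<close>
  avoids the positions in \<open>{i<..J}\<close>.\<close>

definition attained_beyond :: "nat \<Rightarrow> (nat \<Rightarrow> nat) \<Rightarrow> nat \<Rightarrow> nat \<Rightarrow> bool" where
  "attained_beyond n u i J \<longleftrightarrow> dual_rajcode n u i = 0 \<or>
     (\<exists>x\<in>{J<..n}. i < x \<and> u i < u x \<and> dual_rajcode n u i = dual_rajcode n u x + 1)"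

text \<open>The unit that a descending run in row \<open>i\<close> may still lose after a swap with
  \<open>J\<close>; the marking that opened the run pays for it.\<close>

definition defect :: "nat \<Rightarrow> (nat \<Rightarrow> nat) \<Rightarrow> nat \<Rightarrow> nat \<Rightarrow> int" where
  "defect n u i J = (if attained_beyond n u i J then 0 else 1)"

lemma defect_bounds: "0 \<le> defect n u i J" "defect n u i J \<le> 1"
  by (auto simp: defect_def)

context transposition_cover
begin

text \<open>Since \<open>v i = u j\<close>, a position that continues a longest sequence from
  \<open>j\<close> in \<open>u\<close> can follow \<open>i\<close> in \<open>v\<close>, and its own
  code has not dropped. If the bound is an equality, that position witnesses
  \<open>attained_beyond\<close>.\<close>

lemma dual_rajcode_swap_le: "dual_rajcode n u j \<le> dual_rajcode n v i"
  and attained_beyond_swap: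
    "dual_rajcode n v i = dual_rajcode n u j \<Longrightarrow> attained_beyond n v i j"
proof -
  have "dual_rajcode n u j \<le> dual_rajcode n v i \<and>
    (dual_rajcode n v i = dual_rajcode n u j \<longrightarrow> attained_beyond n v i j)"
    using j_in
  proof (cases rule: dual_rajcode_cases[where u = u])
    case zero
    then show ?thesis using dual_rajcode_bounds(1)[OF i_in] by (auto simp: attained_beyond_def)
  next
    case (next_pos x)
    have "dual_rajcode n u x \<le> dual_rajcode n v x"
      using next_pos bounds by (intro dual_rajcode_mono) auto
    moreover have "dual_rajcode n v x + 1 \<le> dual_rajcode n v i"
      using next_pos bounds i_in by (intro dual_rajcode_less) auto
    ultimately show ?thesis
      using next_pos bounds by (auto simp: attained_beyond_def intro!: bexI[of _ x])
  qed
  then show "dual_rajcode n u j \<le> dual_rajcode n v i"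
    and "dual_rajcode n v i = dual_rajcode n u j \<Longrightarrow> attained_beyond n v i j" by auto
qed

text \<open>A swap lowers the sum by at most one, and if it does, the new code at \<open>i\<close> is attained
  beyond \<open>j\<close>; then no further swap to the left of \<open>j\<close> loses anything. Hence a descending run of
  swaps costs at most one in total.\<close>

lemma sum_dual_rajcode_swap:
  shows "(\<Sum>k=i..n. dual_rajcode n u k) - 1 \<le> (\<Sum>k=i..n. dual_rajcode n v k) - defect n v i j"
    (is "?F u - 1 \<le> ?F v - _")
  and "j \<le> J \<Longrightarrow> (\<Sum>k=i..n. dual_rajcode n u k) - defect n u i J
    \<le> (\<Sum>k=i..n. dual_rajcode n v k) - defect n v i j"
proof -
  have split: "?F x = dual_rajcode n x i + dual_rajcode n x j +
      (\<Sum>k\<in>{i<..n} - {j}. dual_rajcode n x k)" for x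
  proof -
    have "{i..n} = insert i {i<..n}" using bounds by auto
    then have "?F x = dual_rajcode n x i + (\<Sum>k\<in>{i<..n}. dual_rajcode n x k)" by simp
    also have "(\<Sum>k\<in>{i<..n}. dual_rajcode n x k) =
        dual_rajcode n x j + (\<Sum>k\<in>{i<..n} - {j}. dual_rajcode n x k)"
      using bounds by (intro sum.remove) auto
    finally show ?thesis by simp
  qed
  have rest: "(\<Sum>k\<in>{i<..n} - {j}. dual_rajcode n u k) \<le> (\<Sum>k\<in>{i<..n} - {j}. dual_rajcode n v k)"
    by (intro sum_mono dual_rajcode_mono) auto
  have j_le: "dual_rajcode n u j \<le> dual_rajcode n v j"
    using bounds by (intro dual_rajcode_mono) auto
  have d: "dual_rajcode n u j + defect n v i j \<le> dual_rajcode n v i"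
    using dual_rajcode_swap_le attained_beyond_swap by (force simp: defect_def)
  have pos: "dual_rajcode n u i \<noteq> 0"
    using dual_rajcode_less[of i n j u] dual_rajcode_bounds(1)[OF j_in, of u] bounds ascent by auto
  \<comment> \<open>Nothing is lost here: as \<open>v j = u i\<close>, position \<open>j\<close>
    inherits at least the old code of \<open>i\<close> through \<open>x\<close>, while
    \<open>d\<close> gives \<open>i\<close> at least the old code of \<open>j\<close> plus the
    defect.\<close>
  have beyond: "?F u \<le> ?F v - defect n v i j"
    if x: "j < x" "x \<le> n" "u i < u x" "dual_rajcode n u i = dual_rajcode n u x + 1" for x
  proof -
    have "dual_rajcode n u x \<le> dual_rajcode n v x"
      using x bounds by (intro dual_rajcode_mono) auto
    moreover have "dual_rajcode n v x + 1 \<le> dual_rajcode n v j"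
      using x bounds j_in by (intro dual_rajcode_less) auto
    ultimately show ?thesis using split[of u] split[of v] rest d x(4) by linarith
  qed
  show gen: "?F u - 1 \<le> ?F v - defect n v i j"
    using i_in
  proof (cases rule: dual_rajcode_cases[where u = u])
    case zero
    with pos show ?thesis by simp
  next
    case (next_pos x)
    consider "x < j" | "x = j" | "j < x" by linarith
    then show ?thesis
    proof cases
      \<comment> \<open>\<open>gap\<close> puts \<open>u x\<close> above \<open>u j\<close>, so
        \<open>x\<close> can still follow \<open>i\<close> and the sum does not drop; the 1
        subtracted on the left covers the defect.\<close>
      case 1
      then have "v i < v x" using next_pos gap_cases[of x] by auto
      then have "dual_rajcode n v x + 1 \<le> dual_rajcode n v i"
        using next_pos i_in by (intro dual_rajcode_less) auto
      moreover have "dual_rajcode n u x \<le> dual_rajcode n v x"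
        using next_pos by (intro dual_rajcode_mono) auto
      ultimately show ?thesis
        using next_pos split[of u] split[of v] rest j_le defect_bounds[of n v i j] by linarith
    next
      case 2
      then show ?thesis using next_pos split[of u] split[of v] rest j_le d by simp
    next
      case 3
      then show ?thesis using beyond[of x] next_pos by auto
    qed
  qed
  show "?F u - defect n u i J \<le> ?F v - defect n v i j" if "j \<le> J"
  \<comment> \<open>A witness beyond \<open>J\<close> also lies beyond \<open>j\<close>; without one
    the defect of \<open>u\<close> is 1 and the first claim applies.\<close>
  proof (cases "attained_beyond n u i J")
    case True
    then obtain x where "J < x" "x \<le> n" "u i < u x" "dual_rajcode n u i = dual_rajcode n u x + 1"
      using pos by (auto simp: attained_beyond_def)
    with beyond[of x] that True show ?thesis by (simp add: defect_def)
  next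
    case False
    then show ?thesis using gen by (simp add: defect_def)
  qed
qed

end

section \<open>Inversions and Bruhat covers\<close>

text \<open>Every inversion is counted twice, which makes the summand symmetric.\<close>

definition inversion_pairs :: "nat \<Rightarrow> (nat \<Rightarrow> nat) \<Rightarrow> nat" where
  "inversion_pairs n u = (\<Sum>x\<in>{1..n}. \<Sum>y\<in>{1..n}. of_bool (x < y \<and> u y < u x \<or> y < x \<and> u x < u y))"

lemma inversion_pairs_split:
  assumes "i \<in> {1..n}" "j \<in> {1..n}" "i < j"
  defines "A \<equiv> {1..n} - {i, j}"
  shows "inversion_pairs n u =
    (\<Sum>x\<in>A. \<Sum>y\<in>A. of_bool (x < y \<and> u y < u x \<or> y < x \<and> u x < u y)) +
    2 * (\<Sum>x\<in>A. of_bool (x < i \<and> u i < u x \<or> i < x \<and> u x < u i) +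
                of_bool (x < j \<and> u j < u x \<or> j < x \<and> u x < u j)) +
    2 * of_bool (u j < u i)"
proof -
  define g where "g x y = (of_bool (x < y \<and> u y < u x \<or> y < x \<and> u x < u y) :: nat)" for x y
  have g: "g x y = g y x" "g x x = 0" for x y by (auto simp: g_def)
  have flip: "(\<Sum>x\<in>A. g i x) = (\<Sum>x\<in>A. g x i)" "(\<Sum>x\<in>A. g j x) = (\<Sum>x\<in>A. g x j)" "g j i = g i j"
    by (intro sum.cong refl g(1))+
  have S: "{1..n} = insert i (insert j A)" "finite A" "i \<notin> A" "j \<notin> A" "i \<noteq> j"
    using assms by auto
  have "inversion_pairs n u = (\<Sum>x\<in>insert i (insert j A). \<Sum>y\<in>insert i (insert j A). g x y)"
    unfolding inversion_pairs_def S(1) g_def ..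
  also have "\<dots> = (\<Sum>x\<in>A. \<Sum>y\<in>A. g x y) + 2 * (\<Sum>x\<in>A. g x i + g x j) + 2 * g i j"
    using S(2-5) by (simp add: sum.distrib g(2) flip)
  also have "g i j = of_bool (u j < u i)" using assms(3) by (simp add: g_def)
  finally show ?thesis by (simp only: g_def)
qed

text \<open>The pair \<open>i\<close>, \<open>j\<close> becomes an inversion and counts 2. Any other
  position contributes at least as much as before, and more only if it lies between \<open>i\<close>
  and \<open>j\<close> both in position and in value.\<close>

lemma inversion_pairs_swap:
  assumes "i \<in> {1..n}" "j \<in> {1..n}" "i < j" "u i < u j"
  shows "inversion_pairs n u + 2 \<le> inversion_pairs n (u \<circ> transpose i j)"
    and "(\<And>k. i < k \<Longrightarrow> k < j \<Longrightarrow> u k < u i \<or> u j < u k) \<Longrightarrow>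
      inversion_pairs n (u \<circ> transpose i j) = inversion_pairs n u + 2"
proof -
  let ?v = "u \<circ> transpose i j" and ?A = "{1..n} - {i, j}"
  let ?g = "\<lambda>w x. of_bool (x < i \<and> w i < w x \<or> i < x \<and> w x < w i) +
                of_bool (x < j \<and> w j < w x \<or> j < x \<and> w x < (w j :: nat)) :: nat"
  have v: "?v i = u j" "?v j = u i" "x \<in> ?A \<Longrightarrow> ?v x = u x" for x
    by (auto simp: transpose_def o_apply)
  have rest: "(\<Sum>x\<in>?A. \<Sum>y\<in>?A. of_bool (x < y \<and> ?v y < ?v x \<or> y < x \<and> ?v x < ?v y)) =
    (\<Sum>x\<in>?A. \<Sum>y\<in>?A. of_bool (x < y \<and> u y < u x \<or> y < x \<and> u x < u y) :: nat)"
    using v(3) by (intro sum.cong refl) (simp only: v(3))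
  have le: "?g u x \<le> ?g ?v x" if "x \<in> ?A" for x
    using that assms(3,4) unfolding v(1,2) v(3)[OF that] by (auto simp: of_bool_def)
  have eq: "?g ?v x = ?g u x" if "x \<in> ?A" "\<And>k. i < k \<Longrightarrow> k < j \<Longrightarrow> u k < u i \<or> u j < u k" for x
    using that(1) that(2)[of x] assms(3,4) unfolding v(1,2) v(3)[OF that(1)]
    by (cases x j rule: linorder_cases) (auto simp: of_bool_def)
  have swap: "of_bool (?v j < ?v i) = (1 :: nat)" "of_bool (u j < u i) = (0 :: nat)"
    using assms(4) by (simp_all only: v) auto
  show "inversion_pairs n u + 2 \<le> inversion_pairs n ?v"
    unfolding inversion_pairs_split[OF assms(1-3)] rest swap
    using sum_mono[of ?A "?g u" "?g ?v", OF le] by linarith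
  show "inversion_pairs n ?v = inversion_pairs n u + 2"
    if "\<And>k. i < k \<Longrightarrow> k < j \<Longrightarrow> u k < u i \<or> u j < u k"
    unfolding inversion_pairs_split[OF assms(1-3)] rest swap
    using sum.cong[of ?A ?A "?g ?v" "?g u", OF refl eq[OF _ that]] by linarith
qed

lemma bruhat_le_inversion_pairs:
  assumes "(u, v) \<in> bruhat_le n"
  shows "u = v \<or> inversion_pairs n u + 2 \<le> inversion_pairs n v"
  using assms unfolding bruhat_le_def
proof (induction rule: rtrancl_induct)
  case (step y z)
  then obtain w i j where yz: "y = w" "z = w \<circ> transpose i j" "i \<in> {1..n}" "j \<in> {1..n}" "i < j" "w i < w j"
    by blast
  then have "inversion_pairs n y + 2 \<le> inversion_pairs n z"
    unfolding yz by (intro inversion_pairs_swap(1))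
  with step.IH show ?case by auto
qed simp

lemma bruhat_le_swap:
  assumes "u permutes {1..n}" "i \<in> {1..n}" "j \<in> {1..n}" "i < j" "u i < u j"
  shows "(u, u \<circ> transpose i j) \<in> bruhat_le n"
  using assms unfolding bruhat_le_def by (intro r_into_rtrancl) blast

text \<open>Under the gap condition \<open>inversion_pairs\<close> rises by 2, the least possible
  rise, so nothing fits in between. Conversely, a descent would make the swap go down, against the
  count, and a value in the gap would yield an intermediate permutation.\<close>

lemma bruhat_cover_swap_iff:
  assumes u: "u permutes {1..n}" and ij: "1 \<le> i" "i < j" "j \<le> n"
  shows "bruhat_cover n u (u \<circ> transpose i j) \<longleftrightarrow> transposition_cover n u i j"
proof
  let ?v = "u \<circ> transpose i j"
  have mem: "i \<in> {1..n}" "j \<in> {1..n}" using ij by auto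
  have inj: "u x = u y \<longleftrightarrow> x = y" for x y
    using u by (metis permutes_inj injD)
  have perm_swap: "u' \<circ> transpose a b permutes {1..n}"
    if "u' permutes {1..n}" "a \<in> {1..n}" "b \<in> {1..n}" for u' a b
    using that by (intro permutes_compose permutes_swap_id)
  {
    assume "transposition_cover n u i j"
    then interpret transposition_cover n u i j .
    have two: "inversion_pairs n ?v = inversion_pairs n u + 2"
      using mem ij ascent gap_cases by (intro inversion_pairs_swap(2)) auto
    show "bruhat_cover n u ?v"
      unfolding bruhat_cover_def
    proof (intro conjI allI impI)
      show "(u, ?v) \<in> bruhat_le n"
        using u mem ij ascent by (intro bruhat_le_swap) auto
      show "u \<noteq> ?v" using two by fastforce
      fix z assume "(u, z) \<in> bruhat_le n \<and> (z, ?v) \<in> bruhat_le n"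
      then show "z = u \<or> z = ?v"
        using bruhat_le_inversion_pairs[of u z n] bruhat_le_inversion_pairs[of z ?v n] two by auto
    qed
  }
  {
    assume cov: "bruhat_cover n u ?v"
    then have le: "(u, ?v) \<in> bruhat_le n" and ne: "u \<noteq> ?v" by (auto simp: bruhat_cover_def)
    have vv: "?v \<circ> transpose i j = u" by (simp add: comp_assoc)
    have asc: "u i < u j"
    proof (rule ccontr)
      assume "\<not> u i < u j"
      then have "?v i < ?v j" using inj[of i j] ij by (auto simp: o_apply)
      then have "(?v, u) \<in> bruhat_le n"
        using bruhat_le_swap[of ?v n i j] perm_swap u mem ij vv by auto
      then show False
        using bruhat_le_inversion_pairs[OF le] bruhat_le_inversion_pairs[of ?v u n] ne by auto
    qed
    show "transposition_cover n u i j"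
    proof unfold_locales
      fix k assume k: "i < k" "k < j"
      show "\<not> (u i < u k \<and> u k < u j)"
      proof
        assume uk: "u i < u k \<and> u k < u j"
        have mk: "k \<in> {1..n}" using k ij by auto
        \<comment> \<open>Swapping \<open>i\<close> with \<open>k\<close>, then \<open>i\<close>
          with \<open>j\<close>, then \<open>k\<close> with \<open>j\<close> amounts to swapping
          \<open>i\<close> with \<open>j\<close>. With \<open>u k\<close> in the gap all three are
          ascents, so \<open>x\<close> lies strictly between.\<close>
        define x where "x = u \<circ> transpose i k"
        define y where "y = x \<circ> transpose i j"
        have x: "x i = u k" "x k = u i" "x j = u j"
          using k by (auto simp: x_def transpose_def o_apply)
        have y: "y i = u j" "y k = u i" "y j = u k"
          using k x by (auto simp: y_def transpose_def o_apply)
        have px: "x permutes {1..n}" unfolding x_def by (intro perm_swap u mem mk)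
        have py: "y permutes {1..n}" unfolding y_def by (intro perm_swap px mem mk)
        have yv: "y \<circ> transpose k j = ?v"
        proof
          fix a show "(y \<circ> transpose k j) a = ?v a"
            using k by (auto simp: y_def x_def transpose_def o_apply)
        qed
        have 1: "(u, x) \<in> bruhat_le n"
          unfolding x_def using u mem mk k uk by (intro bruhat_le_swap) auto
        have 2: "(x, y) \<in> bruhat_le n"
          unfolding y_def using px mem ij uk x by (intro bruhat_le_swap) auto
        have 3: "(y, ?v) \<in> bruhat_le n"
          unfolding yv[symmetric] using py mem mk k uk y by (intro bruhat_le_swap) auto
        have "(x, ?v) \<in> bruhat_le n" using 2 3 by (auto simp: bruhat_le_def)
        with 1 cov have "x = u \<or> x = ?v" by (auto simp: bruhat_cover_def)
        moreover have "x \<noteq> u" using x uk by auto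
        moreover have "x \<noteq> ?v" using x(3) asc inj[of i j] ij by (auto simp: o_apply)
        ultimately show False by blast
      qed
    qed (use u ij asc in auto)
  }
qed

section \<open>Climbing chains and markings by recursion on the list\<close>

fun climbing_from :: "nat \<Rightarrow> nat \<Rightarrow> (nat \<Rightarrow> nat) \<Rightarrow> (nat \<times> nat) list \<Rightarrow> bool" where
  "climbing_from n b u [] \<longleftrightarrow> u = longest_perm n"
| "climbing_from n b u ((i, j) # C) \<longleftrightarrow>
    b \<le> i \<and> transposition_cover n u i j \<and> climbing_from n i (u \<circ> transpose i j) C"

text \<open>\<open>p\<close> plays the preceding link. Lists let inductions count markings by
  \<open>length\<close>; \<open>climbing_from_distinct\<close> recovers cardinalities.\<close>

fun marked_links :: "nat \<times> nat \<Rightarrow> (nat \<times> nat) list \<Rightarrow> (nat \<times> nat) list" where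
  "marked_links p [] = []"
| "marked_links p (c # C) =
    (if fst p < fst c \<or> fst p = fst c \<and> snd p < snd c then [c] else []) @ marked_links c C"

lemma climbing_chain_Nil: "climbing_chain n u [] \<longleftrightarrow> u = longest_perm n"
  by (auto simp: climbing_chain_def apply_links_def)

lemma climbing_chain_Cons:
  "climbing_chain n u ((i, j) # C) \<longleftrightarrow>
    1 \<le> i \<and> i < j \<and> j \<le> n \<and> (\<forall>l\<in>set C. i \<le> fst l) \<and>
    bruhat_cover n u (u \<circ> transpose i j) \<and> climbing_chain n (u \<circ> transpose i j) C"
proof -
  have 1: "apply_links w ((i, j) # D) = apply_links (w \<circ> transpose i j) D" for w D
    by (simp add: apply_links_def)
  have 2: "apply_links w [] = w" for w by (simp add: apply_links_def)
  show ?thesis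
    unfolding climbing_chain_def by (auto simp: All_less_Suc2 1 2)
qed

lemma climbing_from_iff:
  assumes "u permutes {1..n}"
  shows "climbing_from n b u C \<longleftrightarrow> climbing_chain n u C \<and> (\<forall>l\<in>set C. b \<le> fst l)"
  using assms
proof (induction C arbitrary: b u)
  case Nil
  then show ?case by (simp add: climbing_chain_Nil)
next
  case (Cons c C)
  obtain i j where c: "c = (i, j)" by (cases c)
  show ?case
  proof (cases "1 \<le> i \<and> i < j \<and> j \<le> n")
    case True
    then have "u \<circ> transpose i j permutes {1..n}"
      using Cons.prems by (intro permutes_compose permutes_swap_id) auto
    from Cons.IH[OF this, of i] bruhat_cover_swap_iff[OF Cons.prems, of i j] True
    show ?thesis by (auto simp: c climbing_chain_Cons)
  next
    case False
    then show ?thesis by (auto simp: c climbing_chain_Cons transposition_cover_def)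
  qed
qed

lemma (in transposition_cover) v_permutes: "v permutes {1..n}"
  using bounds by (intro permutes_compose permutes_swap_id perm) auto

lemma climbing_from_final:
  assumes "climbing_from n b u C" "k < b"
  shows "u k = longest_perm n k"
  using assms
proof (induction C arbitrary: b u)
  case (Cons c C)
  obtain i j where c: "c = (i, j)" by (cases c)
  from Cons.prems c have *: "b \<le> i" "transposition_cover n u i j" "climbing_from n i (u \<circ> transpose i j) C"
    by auto
  then interpret transposition_cover n u i j by simp
  have "v k = longest_perm n k" using * Cons.prems by (intro Cons.IH[of i v]) auto
  then show ?case using * Cons.prems bounds by simp
qed auto

lemma climbing_from_fst: "climbing_from n b u C \<Longrightarrow> l \<in> set C \<Longrightarrow> b \<le> fst l"
  by (induction C arbitrary: b u) fastforce+

lemma climbing_from_mono: "climbing_from n b u C \<Longrightarrow> b' \<le> b \<Longrightarrow> climbing_from n b' u C"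
  by (cases C) auto

text \<open>While row \<open>i\<close> lasts, the value at \<open>i\<close> only grows, so the
  smaller value at \<open>j\<close> never forms an ascent with it and stays put; later rows have
  larger first indices.\<close>

lemma climbing_from_notin:
  assumes "climbing_from n i u C" "u j < u i"
  shows "(i, j) \<notin> set C"
  using assms
proof (induction C arbitrary: u)
  case (Cons c C)
  obtain a b where c: "c = (a, b)" by (cases c)
  from Cons.prems c have *: "i \<le> a" "transposition_cover n u a b" "climbing_from n a (u \<circ> transpose a b) C"
    by auto
  then interpret transposition_cover n u a b by simp
  show ?case
  proof (cases "a = i")
    case True
    then have j: "j \<noteq> b" "j \<noteq> i" using ascent Cons.prems by auto
    with True have "v j < v i" using v_simps(1) v_simps(3)[of j] ascent Cons.prems by simp
    with * True j have "(i, j) \<notin> set C" by (intro Cons.IH[of v]) auto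
    with j have "(i, j) \<notin> set C \<and> j \<noteq> b" by simp
    then show ?thesis using c True by simp
  next
    case False
    then show ?thesis using climbing_from_fst[OF *(3), of "(i, j)"] * c by auto
  qed
qed auto

lemma climbing_from_distinct: "climbing_from n b u C \<Longrightarrow> distinct C"
proof (induction C arbitrary: b u)
  case (Cons c C)
  obtain i j where c: "c = (i, j)" by (cases c)
  from Cons.prems c have *: "transposition_cover n u i j" "climbing_from n i (u \<circ> transpose i j) C"
    by auto
  then interpret transposition_cover n u i j by simp
  have "(i, j) \<notin> set C" using *(2) ascent by (intro climbing_from_notin[of n i v]) auto
  then show ?case using Cons.IH[OF *(2)] c by simp
qed simp

lemma set_marked_links_subset: "set (marked_links p C) \<subseteq> set C"
  by (induction C arbitrary: p) (auto split: if_splits)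

lemma distinct_marked_links: "distinct C \<Longrightarrow> distinct (marked_links p C)"
  by (induction C arbitrary: p) (use set_marked_links_subset in force)+

lemma set_marked_links:
  "set (marked_links p C) = {C ! q | q. q < length C \<and>
    (fst ((p # C) ! q) < fst (C ! q) \<or> fst ((p # C) ! q) = fst (C ! q) \<and> snd ((p # C) ! q) < snd (C ! q))}"
  (is "_ = {C ! q | q. q < length C \<and> ?P p C q}")
proof (induction C arbitrary: p)
  case (Cons c C)
  have "{(c # C) ! q | q. q < length (c # C) \<and> ?P p (c # C) q} =
    (if ?P p (c # C) 0 then {c} else {}) \<union> {C ! q | q. q < length C \<and> ?P c C q}"
    (is "?L = ?R")
  proof (rule set_eqI)
    fix x
    have "x \<in> ?L \<longleftrightarrow> (\<exists>q<Suc (length C). x = (c # C) ! q \<and> ?P p (c # C) q)" by auto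
    also have "\<dots> \<longleftrightarrow> x \<in> ?R" by (subst Ex_less_Suc2) auto
    finally show "x \<in> ?L \<longleftrightarrow> x \<in> ?R" .
  qed
  then show ?case by (simp only: marked_links.simps set_append Cons.IH) auto
qed simp

text \<open>As first indices are positive, the predecessor \<open>(0, 0)\<close> never ties with the
  first link, which is the convention for \<open>q = 0\<close>.\<close>

lemma min_markings_eq_marked_links:
  assumes "\<And>l. l \<in> set C \<Longrightarrow> 1 \<le> fst l"
  shows "min_markings C = set (marked_links (0, 0) C)"
proof -
  have "((if q = 0 then 0 else fst (C ! (q - 1))) < fst (C ! q) \<or>
         (q > 0 \<and> fst (C ! (q - 1)) = fst (C ! q) \<and> snd (C ! (q - 1)) < snd (C ! q))) \<longleftrightarrow>
     (fst (((0, 0) # C) ! q) < fst (C ! q) \<or>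
       fst (((0, 0) # C) ! q) = fst (C ! q) \<and> snd (((0, 0) # C) ! q) < snd (C ! q))"
    if "q < length C" for q
    using that assms[of "C ! q"] by (cases q) auto
  then show ?thesis unfolding min_markings_def set_marked_links by blast
qed

section \<open>Lower bound for the number of markings\<close>

lemma dual_rajcode_final:
  assumes "u permutes {1..n}" "\<And>m. m \<le> k \<Longrightarrow> u m = longest_perm n m" "k \<in> {1..n}"
  shows "dual_rajcode n u k = 0"
  using assms(3)
proof (cases rule: dual_rajcode_cases[where u = u])
  case (next_pos x)
  have "x \<in> {1..n}" using next_pos assms(3) by auto
  then have "u x \<in> {1..n}" using permutes_in_image[OF assms(1)] by simp
  \<comment> \<open>\<open>m\<close> is where the longest permutation takes the value
    \<open>u x\<close>. As \<open>u k < u x\<close>, it is at most \<open>k\<close>, where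
    \<open>u\<close> is already final; injectivity then forces \<open>m = x\<close>, against
    \<open>k < x\<close>.\<close>
  define m where "m = n + 1 - u x"
  have "u k = n + 1 - k" using assms by (simp add: longest_perm_def)
  then have m: "m \<le> k" "m \<in> {1..n}"
    using next_pos \<open>u x \<in> {1..n}\<close> assms(3) by (auto simp: m_def)
  then have "u m = u x"
    using assms(2)[of m] \<open>u x \<in> {1..n}\<close> by (auto simp: longest_perm_def m_def)
  then have "m = x" using assms(1) by (metis permutes_inj injD)
  with m next_pos show ?thesis by auto
qed

lemma sum_dual_rajcode_final:
  assumes "u permutes {1..n}" "\<And>m. m < i \<Longrightarrow> u m = longest_perm n m" "1 \<le> b" "b \<le> i" "i \<le> n"
  shows "(\<Sum>k=b..n. dual_rajcode n u k) = (\<Sum>k=i..n. dual_rajcode n u k)"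
proof (rule sum.mono_neutral_right)
  show "\<forall>k\<in>{b..n} - {i..n}. dual_rajcode n u k = 0"
    using assms by (intro ballI dual_rajcode_final) auto
qed (use assms in auto)

text \<open>The added 1 is for the link that opens row \<open>i\<close>, which is always marked; the
  rows from \<open>b\<close> to before \<open>i\<close> are final and have code 0.\<close>

lemma (in transposition_cover) sum_le_new_row:
  assumes "climbing_from n i v C" "1 \<le> b" "b \<le> i"
    and "(\<Sum>k=i..n. dual_rajcode n v k) - defect n v i j \<le> c"
  shows "(\<Sum>k=b..n. dual_rajcode n u k) \<le> c + 1"
proof -
  have "u m = longest_perm n m" if "m < i" for m
    using climbing_from_final[OF assms(1) that] that bounds by simp
  then have "(\<Sum>k=b..n. dual_rajcode n u k) = (\<Sum>k=i..n. dual_rajcode n u k)"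
    using assms(2,3) perm bounds by (intro sum_dual_rajcode_final) auto
  then show ?thesis using sum_dual_rajcode_swap(1) assms(4) by linarith
qed

text \<open>\<open>(i, J)\<close> is the preceding link. By \<open>sum_dual_rajcode_swap\<close> the
  left side drops by at most one at a marked link and not at all at an unmarked one, and it is at
  most 0 when the chain ends.\<close>

lemma length_marked_links_ge:
  assumes "climbing_from n i u C" "u permutes {1..n}" "1 \<le> i"
  shows "(\<Sum>k=i..n. dual_rajcode n u k) - defect n u i J \<le> int (length (marked_links (i, J) C))"
  using assms
proof (induction C arbitrary: i u J)
  case Nil
  then have "dual_rajcode n u k = 0" if "k \<in> {i..n}" for k
    using that by (intro dual_rajcode_final) auto
  then show ?case using defect_bounds(1)[of n u i J] by simp
next
  case (Cons c C)
  obtain a j where c: "c = (a, j)" by (cases c)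
  from Cons.prems c have *: "i \<le> a" "transposition_cover n u a j" "climbing_from n a (u \<circ> transpose a j) C"
    by auto
  then interpret transposition_cover n u a j by simp
  note IH = Cons.IH[OF *(3) v_permutes bounds(1), of j]
  show ?case
  proof (cases "a = i")
    case True
    then show ?thesis
      using IH c sum_dual_rajcode_swap(1) sum_dual_rajcode_swap(2)[of J] defect_bounds(1)[of n u i J]
      by (cases "j \<le> J") auto
  next
    case False
    then show ?thesis
      using sum_le_new_row[OF *(3) \<open>1 \<le> i\<close> *(1) IH] *(1) c defect_bounds(1)[of n u i J] by auto
  qed
qed

text \<open>Links in rows before \<open>b\<close> never lower the codes from \<open>b\<close> on.
  The first link in a row from \<open>b\<close> on opens that row, since \<open>fst p < b\<close>,
  and from there every marking counts.\<close>

lemma length_marked_links_tail_ge: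
  assumes "climbing_from n (fst p) u C" "u permutes {1..n}" "fst p < b"
  shows "(\<Sum>k=b..n. dual_rajcode n u k) \<le>
    int (length (filter (\<lambda>l. b \<le> fst l) (marked_links p C)))"
  using assms
proof (induction C arbitrary: p u)
  case Nil
  then have "dual_rajcode n u k = 0" if "k \<in> {b..n}" for k
    using that by (intro dual_rajcode_final) auto
  then show ?case by simp
next
  case (Cons c C)
  obtain i j where c: "c = (i, j)" by (cases c)
  from Cons.prems c have *: "fst p \<le> i" "transposition_cover n u i j" "climbing_from n i (u \<circ> transpose i j) C"
    by auto
  then interpret transposition_cover n u i j by simp
  show ?case
  proof (cases "i < b")
    case True
    have "(\<Sum>k=b..n. dual_rajcode n u k) \<le> (\<Sum>k=b..n. dual_rajcode n v k)"
      using True by (intro sum_mono dual_rajcode_mono) auto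
    also have "\<dots> \<le> int (length (filter (\<lambda>l. b \<le> fst l) (marked_links (i, j) C)))"
      using *(3) v_permutes True by (intro Cons.IH) auto
    finally show ?thesis using True c by simp
  next
    case False
    have "filter (\<lambda>l. b \<le> fst l) (marked_links (i, j) C) = marked_links (i, j) C"
      using set_marked_links_subset[of "(i, j)" C] climbing_from_fst[OF *(3)] False
      by (force simp: filter_id_conv)
    moreover note sum_le_new_row[OF *(3) _ _ length_marked_links_ge[OF *(3) v_permutes bounds(1), of j], of b]
    ultimately show ?thesis using False c Cons.prems by auto
  qed
qed

section \<open>A greedy chain attaining the bound in each row\<close>

text \<open>These positions can come second in a longest increasing sequence from
  \<open>i\<close>.\<close>

definition top_level :: "nat \<Rightarrow> (nat \<Rightarrow> nat) \<Rightarrow> nat \<Rightarrow> nat set" where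
  "top_level n u i = {k \<in> {i<..n}. u i < u k \<and> dual_rajcode n u i = dual_rajcode n u k + 1}"

text \<open>Always swapping with the rightmost element of \<open>top_level\<close> changes no code to the right of
  \<open>i\<close>; successive swaps move left until the level is exhausted and the code at \<open>i\<close> drops by one,
  so that each value of the code costs one marking.\<close>

lemma climbing_from_exists:
  assumes "u permutes {1..n}" "\<And>m. m < i \<Longrightarrow> u m = longest_perm n m" "1 \<le> i" "i \<le> n + 1"
  shows "\<exists>C. climbing_from n i u C \<and>
    (\<forall>k\<in>{i..n}. int (length (filter (\<lambda>l. fst l = k) (marked_links (i, J) C))) \<le> dual_rajcode n u k) \<and>
    (i \<le> n \<and> top_level n u i \<noteq> {} \<and> top_level n u i \<subseteq> {..J} \<longrightarrow>
      int (length (filter (\<lambda>l. fst l = i) (marked_links (i, J) C))) \<le> dual_rajcode n u i - 1)"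
  using assms
\<comment> \<open>A lexicographic measure: \<open>n - u i\<close> is at most \<open>n\<close>, so
  passing to the next row outweighs it; within a row each swap raises the value at
  \<open>i\<close>.\<close>
proof (induction "(n + 1 - i) * (n + 1) + (n - u i)" arbitrary: i u J rule: less_induct)
  case less
  show ?case
  proof (cases "i \<le> n")
    case False
    with less.prems have "i = n + 1" by simp
    have "u = longest_perm n"
    proof
      fix m show "u m = longest_perm n m"
      proof (cases "m < i")
        case False
        then have "m \<notin> {1..n}" using \<open>i = n + 1\<close> by auto
        then show ?thesis using permutes_not_in[OF less.prems(1), of m] by (auto simp: longest_perm_def)
      qed (rule less.prems(2))
    qed
    then show ?thesis using False by (intro exI[of _ "[]"]) auto
  next
    case i: True
    then have i_in: "i \<in> {1..n}" using less.prems by auto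
    let ?K = "top_level n u i"
    show ?thesis
    proof (cases "?K = {}")
      case True
      have zero: "dual_rajcode n u i = 0"
        using i_in by (cases rule: dual_rajcode_cases[where u = u]) (use True in \<open>auto simp: top_level_def\<close>)
      have ui: "u i = longest_perm n i"
      proof -
        have "longest_perm n i \<in> {1..n}" using i_in by (auto simp: longest_perm_def)
        then obtain x where x: "x \<in> {1..n}" "u x = longest_perm n i"
          using less.prems(1) by (metis imageE permutes_image)
        have "\<not> x < i" using less.prems(2)[of x] x i_in by (auto simp: longest_perm_def)
        moreover have "\<not> u i < u x" if "i < x"
          using dual_rajcode_less[of i n x u] dual_rajcode_bounds(1)[of x n u] that x i_in zero by auto
        moreover have "u i \<le> u x"
        proof (rule ccontr)
          assume *: "\<not> u i \<le> u x"
          have "u i \<in> {1..n}" using permutes_in_image[OF less.prems(1)] i_in by blast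
          with * x(2) i_in have m: "n + 1 - u i < i" "u (n + 1 - u i) = u i"
            using less.prems(2)[of "n + 1 - u i"] by (auto simp: longest_perm_def)
          then show False using less.prems(1) by (metis permutes_inj injD less_irrefl)
        qed
        ultimately show ?thesis using x by (cases i x rule: linorder_cases) auto
      qed
      obtain d where d: "n = i + d" using i le_Suc_ex by blast
      have lt: "(n + 1 - Suc i) * (n + 1) + (n - u (Suc i)) < (n + 1 - i) * (n + 1) + (n - u i)"
        using d by simp
      have final: "u m = longest_perm n m" if "m < Suc i" for m
        using less.prems(2)[of m] ui that by (cases "m = i") auto
      have "1 \<le> Suc i" "Suc i \<le> n + 1" using i by auto
      from less.hyps[OF lt less.prems(1) final this, of 0]
      obtain C where C: "climbing_from n (Suc i) u C"
        "\<And>k. k\<in>{Suc i..n} \<Longrightarrow> int (length (filter (\<lambda>l. fst l = k) (marked_links (Suc i, 0) C))) \<le> dual_rajcode n u k"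
        by blast
      \<comment> \<open>The first link of \<open>C\<close> lies in a row beyond \<open>i\<close> and
        has a positive second index, so it is marked after either predecessor.\<close>
      have same: "marked_links (i, J) C = marked_links (Suc i, 0) C"
        using C(1) by (cases C) (auto simp: transposition_cover_def)
      have "filter (\<lambda>l. fst l = i) (marked_links (Suc i, 0) C) = []"
        using set_marked_links_subset[of "(Suc i, 0)" C] climbing_from_fst[OF C(1)]
        by (fastforce simp: filter_empty_conv)
      then have "int (length (filter (\<lambda>l. fst l = k) (marked_links (Suc i, 0) C))) \<le> dual_rajcode n u k"
        if "k \<in> {i..n}" for k
        using that C(2)[of k] zero by (cases "k = i") auto
      then show ?thesis
        unfolding same[symmetric] using True climbing_from_mono[OF C(1) le_SucI[OF order_refl]] by blast
    next
      case False
      define j where "j = Max ?K"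
      have fin: "finite ?K" by (simp add: top_level_def)
      have jK: "j \<in> ?K" and j_max: "\<And>k. k \<in> ?K \<Longrightarrow> k \<le> j"
        using fin False by (auto simp: j_def)
      then have j: "i < j" "j \<le> n" "u i < u j" "dual_rajcode n u i = dual_rajcode n u j + 1"
        by (auto simp: top_level_def)
      have below: "dual_rajcode n u x + 1 \<le> dual_rajcode n u i" if "i < x" "x \<le> n" "u i < u x" for x
        using that i_in by (intro dual_rajcode_less) auto
      \<comment> \<open>A value in the gap at \<open>k\<close> would put the code of
        \<open>i\<close> above that of \<open>k\<close> and the latter above that of
        \<open>j\<close>, but the codes of \<open>i\<close> and \<open>j\<close> differ by
        one.\<close>
      interpret transposition_cover n u i j
      proof unfold_locales
        fix k assume k: "i < k" "k < j"
        show "\<not> (u i < u k \<and> u k < u j)"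
          using below[of k] dual_rajcode_less[of k n j u] j k by auto
      qed (use less.prems(1,3) j in auto)
      \<comment> \<open>Beyond \<open>j\<close>, positions with values above \<open>u i\<close> are
        outside \<open>?K\<close> by maximality of \<open>j\<close>, so their codes are below that
        of \<open>j\<close>.\<close>
      have stable: "dual_rajcode n v k = dual_rajcode n u k" if "i < k" "k \<le> n" for k
      proof (rule dual_rajcode_stable[OF _ that])
        fix x assume x: "j < x" "x \<le> n" "u i < u x"
        then have "x \<notin> ?K" using j_max by force
        then show "dual_rajcode n u x + 1 \<le> dual_rajcode n u j"
          using below[of x] x j by (auto simp: top_level_def)
      qed
      have up: "u i < u x" "x \<noteq> j" if "x \<noteq> i" "v i < v x" for x
        using that ascent by (cases "x = j"; simp)+
      have vi_le: "dual_rajcode n v i \<le> dual_rajcode n u i"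
        using i_in
      proof (cases rule: dual_rajcode_cases[where u = v])
        case zero
        then show ?thesis using dual_rajcode_bounds(1)[OF i_in] by simp
      next
        case (next_pos x)
        then have x: "i < x" "x \<le> n" "v i < v x" by auto
        then have "u i < u x" using up(1)[of x] by blast
        with below[OF x(1,2)] stable[OF x(1,2)] next_pos(3) show ?thesis by linarith
      qed
      \<comment> \<open>If the code at \<open>i\<close> survives, the next level lies within
        \<open>{..j}\<close>, so the run can go on without a marking: the premise of the third
        clause of the induction hypothesis, with \<open>j\<close> for \<open>J\<close>.\<close>
      have run: "top_level n v i \<noteq> {} \<and> top_level n v i \<subseteq> {..j}"
        if "dual_rajcode n v i = dual_rajcode n u i"
      proof
        show "top_level n v i \<noteq> {}"
          using i_in
        proof (cases rule: dual_rajcode_cases[where u = v])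
          case zero
          with that j dual_rajcode_bounds(1)[OF j_in, of u] show ?thesis by auto
        qed (auto simp: top_level_def)
        show "top_level n v i \<subseteq> {..j}"
        proof
          fix x assume x: "x \<in> top_level n v i"
          then have x: "i < x" "x \<le> n" "v i < v x" "dual_rajcode n v i = dual_rajcode n v x + 1"
            by (auto simp: top_level_def)
          then have "u i < u x" using up(1)[of x] by blast
          with x that stable[OF x(1,2)] have "x \<in> ?K" by (simp add: top_level_def)
          then show "x \<in> {..j}" using j_max by simp
        qed
      qed
      have "u j \<le> n" using perm j_in by (metis atLeastAtMost_iff permutes_in_image)
      then have "(n + 1 - i) * (n + 1) + (n - v i) < (n + 1 - i) * (n + 1) + (n - u i)"
        using ascent by simp
      moreover have "v m = longest_perm n m" if "m < i" for m
        using less.prems(2)[OF that] that bounds by simp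
      ultimately obtain C where C: "climbing_from n i v C"
        "\<And>k. k\<in>{i..n} \<Longrightarrow> int (length (filter (\<lambda>l. fst l = k) (marked_links (i, j) C))) \<le> dual_rajcode n v k"
        "top_level n v i \<noteq> {} \<and> top_level n v i \<subseteq> {..j} \<Longrightarrow>
          int (length (filter (\<lambda>l. fst l = i) (marked_links (i, j) C))) \<le> dual_rajcode n v i - 1"
        using less.hyps[OF _ v_permutes, of i j] less.prems(3,4) i by blast
      \<comment> \<open>Either the run goes on unmarked or the code at \<open>i\<close> has dropped;
        both leave room for a marking of \<open>(i, j)\<close>.\<close>
      have row: "int (length (filter (\<lambda>l. fst l = i) (marked_links (i, j) C))) \<le> dual_rajcode n u i - 1"
      proof (cases "dual_rajcode n v i = dual_rajcode n u i")
        case True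
        then show ?thesis using C(3)[OF run[OF True]] by simp
      next
        case False
        then show ?thesis using C(2)[of i] vi_le i by simp
      qed
      have rows: "int (length (filter (\<lambda>l. fst l = k) (marked_links (i, j) C))) \<le> dual_rajcode n u k"
        if "k \<in> {i<..n}" for k
        using C(2)[of k] stable[of k] that by auto
      have "climbing_from n i u ((i, j) # C)"
        using C(1) transposition_cover_axioms by simp
      moreover have "int (length (filter (\<lambda>l. fst l = k) (marked_links (i, J) ((i, j) # C)))) \<le> dual_rajcode n u k"
        if "k \<in> {i..n}" for k
        using row rows[of k] that by (cases "k = i") auto
      \<comment> \<open>Here \<open>j \<le> J\<close>, so the link \<open>(i, j)\<close> itself is
        unmarked.\<close>
      moreover have "int (length (filter (\<lambda>l. fst l = i) (marked_links (i, J) ((i, j) # C)))) \<le> dual_rajcode n u i - 1"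
        if "?K \<subseteq> {..J}"
        using row jK that by auto
      ultimately show ?thesis by blast
    qed
  qed
qed

section \<open>Tail sums and term orders\<close>

definition tail_sum :: "nat \<Rightarrow> (nat \<Rightarrow> int) \<Rightarrow> nat \<Rightarrow> int" where
  "tail_sum n a j = (\<Sum>k=j..n. a k)"

lemma lookup_xpow_outside: "k \<notin> {1..n} \<Longrightarrow> Poly_Mapping.lookup (xpow n v) k = 0"
  unfolding xpow_def lookup_sum by (intro sum.neutral) (auto simp: lookup_single when_def)

lemma monomials_add: "a \<in> monomials n \<Longrightarrow> b \<in> monomials n \<Longrightarrow> a + b \<in> monomials n"
  using Poly_Mapping.keys_add[of a b] by (auto simp: monomials_def)

lemma zero_in_monomials: "0 \<in> monomials n"
  by (simp add: monomials_def)

lemma single_in_monomials: "k \<in> {1..n} \<Longrightarrow> Poly_Mapping.single k c \<in> monomials n"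
  by (simp add: monomials_def)

lemma sum_in_monomials: "(\<And>x. x \<in> A \<Longrightarrow> f x \<in> monomials n) \<Longrightarrow> sum f A \<in> monomials n"
  by (induction A rule: infinite_finite_induct) (auto simp: zero_in_monomials monomials_add)

lemma xpow_in_monomials: "xpow n v \<in> monomials n"
  unfolding xpow_def by (intro sum_in_monomials single_in_monomials)

context
  fixes n :: nat and r :: "monomial rel"
  assumes order: "term_order n r"
begin

lemma term_order_refl: "a \<in> monomials n \<Longrightarrow> (a, a) \<in> r"
  using order
  by (auto simp: term_order_def linear_order_on_def partial_order_on_def preorder_on_def refl_on_def)

lemma term_order_trans: "(a, b) \<in> r \<Longrightarrow> (b, c) \<in> r \<Longrightarrow> (a, c) \<in> r"
  using order
  by (auto simp: term_order_def linear_order_on_def partial_order_on_def preorder_on_def trans_def)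

lemma term_order_antisym: "(a, b) \<in> r \<Longrightarrow> (b, a) \<in> r \<Longrightarrow> a = b"
  using order
  by (auto simp: term_order_def linear_order_on_def partial_order_on_def antisym_def)

lemma term_order_add_right:
  "a \<in> monomials n \<Longrightarrow> b \<in> monomials n \<Longrightarrow> c \<in> monomials n \<Longrightarrow> (a, b) \<in> r \<Longrightarrow> (a + c, b + c) \<in> r"
  using order by (auto simp: term_order_def)

lemma term_order_add_mono:
  assumes "a \<in> monomials n" "b \<in> monomials n" "c \<in> monomials n" "d \<in> monomials n"
    and "(a, b) \<in> r" "(c, d) \<in> r"
  shows "(a + c, b + d) \<in> r"
proof -
  have "(a + c, b + c) \<in> r" using assms by (intro term_order_add_right)
  moreover have "(b + c, b + d) \<in> r"
    using term_order_add_right[of c d b] assms by (simp add: add.commute)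
  ultimately show ?thesis by (rule term_order_trans)
qed

lemma term_order_cancel:
  assumes "a \<in> monomials n" "b \<in> monomials n" "c \<in> monomials n" "(a + c, b + c) \<in> r"
  shows "(a, b) \<in> r"
proof (cases "(b, a) \<in> r")
  case True
  then have "(b + c, a + c) \<in> r" using assms by (intro term_order_add_right)
  with assms(4) have "a + c = b + c" by (intro term_order_antisym)
  then show ?thesis using assms by (simp add: term_order_refl)
next
  case False
  moreover have "a = b \<or> (a, b) \<in> r \<or> (b, a) \<in> r"
    using order assms(1,2) by (auto simp: term_order_def linear_order_on_def total_on_def)
  ultimately show ?thesis using assms(1) term_order_refl by blast
qed

lemma term_order_single_mono:
  assumes "i \<in> {1..n}" "j \<in> {1..n}" "(var i, var j) \<in> r"
  shows "(Poly_Mapping.single i c, Poly_Mapping.single j c) \<in> r"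
proof (induction c)
  case 0
  then show ?case by (simp add: term_order_refl zero_in_monomials)
next
  case (Suc c)
  have "Poly_Mapping.single k (Suc c) = var k + Poly_Mapping.single k c" for k :: nat
    by (simp flip: single_add)
  with Suc assms show ?case by (auto intro!: term_order_add_mono single_in_monomials)
qed

lemma term_order_sum_mono:
  assumes "\<And>x. x \<in> A \<Longrightarrow> f x \<in> monomials n" "\<And>x. x \<in> A \<Longrightarrow> g x \<in> monomials n"
    "\<And>x. x \<in> A \<Longrightarrow> (f x, g x) \<in> r"
  shows "(sum f A, sum g A) \<in> r"
  using assms
  by (induction A rule: infinite_finite_induct)
    (auto simp: term_order_refl zero_in_monomials intro!: term_order_add_mono sum_in_monomials)

text \<open>With \<open>d j\<close> the difference of the tail sums of \<open>b\<close> and \<open>a\<close> from \<open>j\<close> on, summation by parts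
  gives \<open>x^b \<Prod> x_(j-1)^(d j) = x^a \<Prod> x_j^(d j)\<close>.\<close>

lemma term_order_xpow_dominance:
  assumes var: "\<And>i j. i \<in> {1..n} \<Longrightarrow> j \<in> {1..n} \<Longrightarrow> i < j \<Longrightarrow> (var i, var j) \<in> r"
    and nonneg: "\<And>k. k \<in> {1..n} \<Longrightarrow> 0 \<le> a k" "\<And>k. k \<in> {1..n} \<Longrightarrow> 0 \<le> b k"
    and total: "tail_sum n a 1 = tail_sum n b 1"
    and tails: "\<And>j. j \<in> {1..n} \<Longrightarrow> tail_sum n a j \<le> tail_sum n b j"
  shows "(xpow n a, xpow n b) \<in> r"
proof -
  define d where "d j = tail_sum n b j - tail_sum n a j" for j
  define X where "X = (\<Sum>j\<in>{2..n}. Poly_Mapping.single (j - 1) (nat (d j)))"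
  define Y where "Y = (\<Sum>j\<in>{2..n}. Poly_Mapping.single j (nat (d j)))"
  have d_nonneg: "0 \<le> d j" if "j \<in> {1..n}" for j
    using tails[OF that] by (simp add: d_def)
  have d_diff: "d k + a k = d (Suc k) + b k" if "k \<in> {1..n}" for k
    using that by (simp add: d_def tail_sum_def sum.atLeast_Suc_atMost)
  \<comment> \<open>Equal totals give \<open>d 1 = 0\<close>, so \<open>X\<close> and
    \<open>Y\<close> can start at \<open>j = 2\<close> and no variable of index 0 arises.\<close>
  have d_out: "d 1 = 0" "d (Suc n) = 0"
    using total by (auto simp: d_def tail_sum_def)
  have X: "X \<in> monomials n" and Y: "Y \<in> monomials n"
    unfolding X_def Y_def by (auto intro!: sum_in_monomials single_in_monomials)
  have "(X, Y) \<in> r"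
    unfolding X_def Y_def
    by (rule term_order_sum_mono) (auto intro!: term_order_single_mono single_in_monomials var)
  then have "(X + xpow n a, Y + xpow n a) \<in> r"
    by (intro term_order_add_right X Y xpow_in_monomials)
  also have "Y + xpow n a = X + xpow n b"
  proof (rule poly_mapping_eqI)
    fix k
    have lX: "Poly_Mapping.lookup X k = (if Suc k \<in> {2..n} then nat (d (Suc k)) else 0)"
    proof -
      have "Poly_Mapping.lookup X k = (\<Sum>j\<in>{2..n}. if j = Suc k then nat (d j) else 0)"
        unfolding X_def lookup_sum by (intro sum.cong) (auto simp: lookup_single when_def)
      then show ?thesis by simp
    qed
    have lY: "Poly_Mapping.lookup Y k = (if k \<in> {2..n} then nat (d k) else 0)"
    proof -
      have "Poly_Mapping.lookup Y k = (\<Sum>j\<in>{2..n}. if j = k then nat (d j) else 0)"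
        unfolding Y_def lookup_sum by (intro sum.cong) (auto simp: lookup_single when_def)
      then show ?thesis by simp
    qed
    show "Poly_Mapping.lookup (Y + xpow n a) k = Poly_Mapping.lookup (X + xpow n b) k"
    proof (cases "k \<in> {1..n}")
      case True
      have "int (Poly_Mapping.lookup Y k) = d k"
        using lY True d_out d_nonneg[of k] by (cases "k = 1") auto
      moreover have "int (Poly_Mapping.lookup X k) = d (Suc k)"
        using lX True d_out d_nonneg[of "Suc k"] by (cases "k = n") auto
      ultimately show ?thesis
        using lookup_xpow[of k n a, OF True nonneg(1)[OF True]] lookup_xpow[of k n b, OF True nonneg(2)[OF True]]
          d_diff[OF True] unfolding lookup_add by linarith
    next
      case False
      then show ?thesis using lX lY by (auto simp: lookup_add lookup_xpow_outside)
    qed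
  qed
  finally have "(xpow n a + X, xpow n b + X) \<in> r" by (simp add: add.commute)
  then show ?thesis by (rule term_order_cancel[OF xpow_in_monomials xpow_in_monomials X])
qed

end

section \<open>Minimal markings compared with the rajcode\<close>

lemma sum_dual_weight:
  assumes "finite U"
  shows "(\<Sum>k=b..n. dual_weight U k) = int (card {l \<in> U. fst l \<in> {b..n}})"
proof -
  have "{l \<in> U. fst l \<in> {b..n}} = (\<Union>k\<in>{b..n}. {l \<in> U. fst l = k})" by auto
  also have "int (card \<dots>) = (\<Sum>k=b..n. dual_weight U k)"
    unfolding dual_weight_def using assms by (subst card_UN_disjoint) auto
  finally show ?thesis by simp
qed

lemma climbing_chain_fst: "climbing_chain n w C \<Longrightarrow> l \<in> set C \<Longrightarrow> fst l \<in> {1..n}"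
  by (force simp: climbing_chain_def)

lemma tail_sum_dual_rajcode_le:
  assumes w: "w permutes {1..n}" and C: "climbing_chain n w C" and b: "1 \<le> b"
  shows "tail_sum n (dual_rajcode n w) b \<le> tail_sum n (dual_weight (min_markings C)) b"
proof -
  let ?M = "marked_links (0, 0) C"
  have links: "1 \<le> fst l \<and> fst l \<le> n" if "l \<in> set C" for l
    using climbing_chain_fst[OF C that] by simp
  \<comment> \<open>The bound 0 matches the predecessor \<open>(0, 0)\<close>, whose first index is
    below every \<open>b \<ge> 1\<close>.\<close>
  have chain: "climbing_from n 0 w C"
    using C w by (simp add: climbing_from_iff)
  have mm: "min_markings C = set ?M"
    using links by (intro min_markings_eq_marked_links) auto
  have "tail_sum n (dual_rajcode n w) b \<le> int (length (filter (\<lambda>l. b \<le> fst l) ?M))"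
    unfolding tail_sum_def using chain w b by (intro length_marked_links_tail_ge) auto
  also have "length (filter (\<lambda>l. b \<le> fst l) ?M) = card (set (filter (\<lambda>l. b \<le> fst l) ?M))"
    by (intro distinct_card[symmetric] distinct_filter distinct_marked_links climbing_from_distinct[OF chain])
  also have "set (filter (\<lambda>l. b \<le> fst l) ?M) = {l \<in> min_markings C. fst l \<in> {b..n}}"
    using links set_marked_links_subset[of "(0, 0)" C] by (auto simp: mm)
  also have "int (card \<dots>) = tail_sum n (dual_weight (min_markings C)) b"
    unfolding tail_sum_def mm by (subst sum_dual_weight) auto
  finally show ?thesis .
qed

lemma card_min_markings:
  assumes "climbing_chain n w C"
  shows "int (card (min_markings C)) = tail_sum n (dual_weight (min_markings C)) 1"
proof -
  have "{l \<in> min_markings C. fst l \<in> {1..n}} = min_markings C"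
    using climbing_chain_fst[OF assms] min_markings_subset[of C] by blast
  then show ?thesis
    unfolding tail_sum_def
    by (subst sum_dual_weight) (use finite_subset[OF min_markings_subset[of C]] in auto)
qed

text \<open>In each row the greedy chain has at most as many markings as the code, while
  \<open>tail_sum_dual_rajcode_le\<close> at 1 bounds their total from below; hence equality in
  every row.\<close>

lemma climbing_chain_rajcode_exists:
  assumes w: "w permutes {1..n}"
  obtains C where "climbing_chain n w C"
    "\<And>k. k \<in> {1..n} \<Longrightarrow> dual_weight (min_markings C) k = dual_rajcode n w k"
proof -
  have "w 0 = longest_perm n 0"
    using permutes_not_in[OF w, of 0] by (simp add: longest_perm_def)
  then have "w m = longest_perm n m" if "m < 1" for m using that by simp
  then obtain C where chain: "climbing_from n 1 w C" and marks: "\<And>k. k \<in> {1..n} \<Longrightarrow>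
    int (length (filter (\<lambda>l. fst l = k) (marked_links (1, 0) C))) \<le> dual_rajcode n w k"
    using climbing_from_exists[OF w, of 1 0] by (metis le_add2 order_refl)
  have C: "climbing_chain n w C" and ge: "\<And>l. l \<in> set C \<Longrightarrow> 1 \<le> fst l"
    using chain w by (auto simp: climbing_from_iff)
  have "marked_links (1, 0) C = marked_links (0, 0) C"
    using chain by (cases C) (auto simp: transposition_cover_def)
  then have mm: "min_markings C = set (marked_links (1, 0) C)"
    using min_markings_eq_marked_links[OF ge] by simp
  have le: "dual_weight (min_markings C) k \<le> dual_rajcode n w k" if "k \<in> {1..n}" for k
  proof -
    have "{l \<in> min_markings C. fst l = k} = set (filter (\<lambda>l. fst l = k) (marked_links (1, 0) C))"
      by (auto simp: mm)
    then have "dual_weight (min_markings C) k \<le> int (length (filter (\<lambda>l. fst l = k) (marked_links (1, 0) C)))"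
      unfolding dual_weight_def using card_length by (metis of_nat_mono)
    with marks[OF that] show ?thesis by simp
  qed
  have sums: "(\<Sum>k=1..n. dual_rajcode n w k - dual_weight (min_markings C) k) \<le> 0"
    using tail_sum_dual_rajcode_le[OF w C, of 1] by (simp add: tail_sum_def sum_subtractf)
  have "dual_weight (min_markings C) k = dual_rajcode n w k" if "k \<in> {1..n}" for k
  proof -
    have "dual_rajcode n w k - dual_weight (min_markings C) k
        \<le> (\<Sum>k=1..n. dual_rajcode n w k - dual_weight (min_markings C) k)"
      using le that by (intro member_le_sum) auto
    then show ?thesis using sums le[OF that] by simp
  qed
  with C that show thesis by blast
qed

theorem theorem8p6:
  fixes n :: nat and w :: "nat \<Rightarrow> nat" and r :: "monomial rel"
  assumes "w permutes {1..n}"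
    and "term_order n r"
    and "\<And>i j. i \<in> {1..n} \<Longrightarrow> j \<in> {1..n} \<Longrightarrow> i < j \<Longrightarrow> (var i, var j) \<in> r - Id"
  shows "is_min r {xpow n (dual_weight (min_markings C)) | C. heavy_climbing_chain n w C}
           (xpow n (dual_rajcode n w)) \<and>
         is_max r {xpow n (weight n (min_markings C)) | C. heavy_climbing_chain n w C}
           (xpow n (rajcode n w))"
proof -
  note w = assms(1)
  have var: "\<And>i j. i \<in> {1..n} \<Longrightarrow> j \<in> {1..n} \<Longrightarrow> i < j \<Longrightarrow> (var i, var j) \<in> r"
    using assms(3) by blast
  have raj: "dual_raj n w = tail_sum n (dual_rajcode n w) 1"
    by (simp add: dual_raj_def tail_sum_def)
  \<comment> \<open>Complementing the entries reverses the tail inequalities and keeps totals equal,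
    so the maximum follows from the same dominance lemma with the roles exchanged.\<close>
  have weight: "tail_sum n (weight n U) b = (\<Sum>k=b..n. int n - int k) - tail_sum n (dual_weight U) b"
    and code: "tail_sum n (rajcode n w) b = (\<Sum>k=b..n. int n - int k) - tail_sum n (dual_rajcode n w) b"
    for U b
    by (simp_all add: tail_sum_def weight_def rajcode_def sum_subtractf)
  obtain C where C: "climbing_chain n w C"
    "\<And>k. k \<in> {1..n} \<Longrightarrow> dual_weight (min_markings C) k = dual_rajcode n w k"
    using climbing_chain_rajcode_exists[OF w] by blast
  have "tail_sum n (dual_weight (min_markings C)) 1 = tail_sum n (dual_rajcode n w) 1"
    unfolding tail_sum_def using C(2) by (intro sum.cong) auto
  then have heavy: "heavy_climbing_chain n w C"
    using C(1) by (simp add: heavy_climbing_chain_def card_min_markings raj)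
  have attained: "xpow n (dual_rajcode n w) = xpow n (dual_weight (min_markings C))"
    "xpow n (rajcode n w) = xpow n (weight n (min_markings C))"
    using C(2) by (auto simp: xpow_def weight_def rajcode_def intro!: sum.cong)
  have bound: "(xpow n (dual_rajcode n w), xpow n (dual_weight (min_markings D))) \<in> r \<and>
      (xpow n (weight n (min_markings D)), xpow n (rajcode n w)) \<in> r"
    if "heavy_climbing_chain n w D" for D
  proof -
    have D: "climbing_chain n w D"
      and total: "tail_sum n (dual_rajcode n w) 1 = tail_sum n (dual_weight (min_markings D)) 1"
      using that raj by (auto simp: heavy_climbing_chain_def card_min_markings)
    have tails: "tail_sum n (dual_rajcode n w) b \<le> tail_sum n (dual_weight (min_markings D)) b"
      if "b \<in> {1..n}" for b
      using tail_sum_dual_rajcode_le[OF w D] that by simp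
    show ?thesis
    proof
      show "(xpow n (dual_rajcode n w), xpow n (dual_weight (min_markings D))) \<in> r"
        using assms(2) var total tails
        by (intro term_order_xpow_dominance dual_rajcode_bounds dual_weight_nonneg) auto
      show "(xpow n (weight n (min_markings D)), xpow n (rajcode n w)) \<in> r"
        using assms(2) var total tails weight_nonneg[OF D min_markings_subset]
        by (intro term_order_xpow_dominance dual_rajcode_bounds) (auto simp: weight code)
    qed
  qed
  show ?thesis
    unfolding is_min_def is_max_def using attained heavy bound by blast
qed

end
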